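(* Let $d$ be the metric of a norm on $\mathbb{R}^2$ and let $N\subset\mathbb{R}^2$ be a finite set of $n\ge 2$ terminals. Let $T_S$ be a Steiner minimal tree (SMT) on $N$ and let $T_{\mathrm{opt}}$ be a minimum Steiner point tree (MSPT) on $N$, both with respect to $d$. Let $j$ be the number of edges of integer length in $T_S^*$ (edges of length zero count as having integer length). Then $$\mathrm{beads}(T_S)-\mathrm{beads}(T_{\mathrm{opt}})\le \max\{2n-4-j,\,0\}.$$
   Context: The length of an edge $e=xy$ is $|e|=d(x,y)$. A tree interconnecting a finite terminal set $N$ is an embedded tree with node set $N\cup W$, where $W$ is a finite set of additional nodes (called Steiner points, or Steiner beads), each of degree at least three. Embedded nodes may coincide in position. An SMT on $N$ is a tree interconnecting $N$ of minimum total edge length. For a tree $T$ interconnecting $N$ with $|N|=n\ge2$, $T^*$ denotes the tree obtained by splitting nodes of $T$ until every terminal has degree one and every Steiner point has degree three. To split a node $v$ means to disconnect two or more edges at $v$, connect them instead to a new Steiner point, and join this new point to $v$ by an extra edge. New nodes keep the position of the node they were split from, so the extra edges have length zero. $T^*$ has $n-2$ Steiner points and $m=2n-3$ edges $e_1,\dots,e_m$. The multiset of edge lengths does not depend on the choice of splits. The bead count is $\mathrm{beads}(T)=1-n+\sum_{i=1}^m\lceil|e_i|\rceil$. This equals the number of additional points used when every edge $e$ of $T^*$ is subdivided by $\lceil|e|\rceil-1$ equally spaced points so that all edges have length at most 1, the $n-2$ Steiner points being counted too. An MSPT on $N$ is a tree interconnecting $N$ that minimizes $\mathrm{beads}$ over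 all trees interconnecting $N$. *)

theory Defs
  imports "HOL-Analysis.Analysis"
begin

type_synonym point = "real^2"

definition is_norm :: "(point \<Rightarrow> real) \<Rightarrow> bool" where
  "is_norm \<nu> \<longleftrightarrow>
     (\<forall>x. 0 \<le> \<nu> x) \<and> (\<forall>x. \<nu> x = 0 \<longleftrightarrow> x = 0) \<and>
     (\<forall>c x. \<nu> (c *\<^sub>R x) = \<bar>c\<bar> * \<nu> x) \<and>
     (\<forall>x y. \<nu> (x + y) \<le> \<nu> x + \<nu> y)"

text \<open>Undirected simple graphs, given by a vertex set and a set of two-element edges.\<close>

definition is_cycle :: "'v set set \<Rightarrow> 'v list \<Rightarrow> bool" where
  "is_cycle E c \<longleftrightarrow> 3 \<le> length c \<and> distinct c \<and>
     (\<forall>i<length c. {c ! i, c ! (Suc i mod length c)} \<in> E)"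

definition is_tree :: "'v set \<Rightarrow> 'v set set \<Rightarrow> bool" where
  "is_tree V E \<longleftrightarrow>
     finite V \<and> V \<noteq> {} \<and> (\<forall>e\<in>E. e \<subseteq> V \<and> card e = 2) \<and>
     (\<forall>u\<in>V. \<forall>v\<in>V. (u, v) \<in> {(x, y). {x, y} \<in> E}\<^sup>*) \<and>
     (\<nexists>c. is_cycle E c)"

text \<open>
  A terminal is identified with its position. A Steiner point carries an abstract label, so that
  several nodes may share a position; its position is given by the field \<open>loc\<close>
  (whose values outside \<open>steiners\<close> are irrelevant).
\<close>

datatype node = Terminal point | Steiner nat

record embedded_graph =
  terminals :: "point set"
  steiners :: "nat set"
  edges :: "node set set"
  loc :: "nat \<Rightarrow> point"

definition nodes :: "embedded_graph \<Rightarrow> node set" where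
  "nodes T = Terminal ` terminals T \<union> Steiner ` steiners T"

fun place :: "embedded_graph \<Rightarrow> node \<Rightarrow> point" where
  "place T (Terminal p) = p"
| "place T (Steiner s) = loc T s"

definition node_degree :: "embedded_graph \<Rightarrow> node \<Rightarrow> nat" where
  "node_degree T v = card {e \<in> edges T. v \<in> e}"

text \<open>Well defined on two-element edges because \<open>d\<close> is symmetric.\<close>

definition edge_length :: "(point \<Rightarrow> point \<Rightarrow> real) \<Rightarrow> embedded_graph \<Rightarrow> node set \<Rightarrow> real" where
  "edge_length d T e = (THE r. \<exists>x y. e = {x, y} \<and> r = d (place T x) (place T y))"

definition interconnects :: "embedded_graph \<Rightarrow> point set \<Rightarrow> bool" where
  "interconnects T N \<longleftrightarrow>
     terminals T = N \<and> finite (steiners T) \<and> is_tree (nodes T) (edges T) \<and>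
     (\<forall>s\<in>steiners T. 3 \<le> node_degree T (Steiner s))"

definition total_length :: "(point \<Rightarrow> point \<Rightarrow> real) \<Rightarrow> embedded_graph \<Rightarrow> real" where
  "total_length d T = (\<Sum>e\<in>edges T. edge_length d T e)"

definition SMT :: "(point \<Rightarrow> point \<Rightarrow> real) \<Rightarrow> point set \<Rightarrow> embedded_graph \<Rightarrow> bool" where
  "SMT d N T \<longleftrightarrow> interconnects T N \<and>
     (\<forall>T'. interconnects T' N \<longrightarrow> total_length d T \<le> total_length d T')"

text \<open>
  Splitting the node \<open>v\<close>: the edges in \<open>F\<close> are moved from \<open>v\<close> to the new Steiner point \<open>s\<close>, which
  has the position of \<open>v\<close> and is joined to \<open>v\<close>.
\<close>

definition split_node :: "embedded_graph \<Rightarrow> node \<Rightarrow> node set set \<Rightarrow> nat \<Rightarrow> embedded_graph" where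
  "split_node T v F s = T\<lparr>
     steiners := insert s (steiners T),
     edges := (edges T - F) \<union> (\<lambda>e. insert (Steiner s) (e - {v})) ` F \<union> {{v, Steiner s}},
     loc := (loc T)(s := place T v)\<rparr>"

inductive split_step :: "embedded_graph \<Rightarrow> embedded_graph \<Rightarrow> bool" where
  "\<lbrakk>v \<in> nodes T; F \<subseteq> {e \<in> edges T. v \<in> e}; 2 \<le> card F; s \<notin> steiners T\<rbrakk>
     \<Longrightarrow> split_step T (split_node T v F s)"

text \<open>\<open>full_splitting T T'\<close> says that \<open>T'\<close> is (a choice of) \<open>T\<^sup>*\<close>.\<close>

definition full_splitting :: "embedded_graph \<Rightarrow> embedded_graph \<Rightarrow> bool" where
  "full_splitting T T' \<longleftrightarrow> split_step\<^sup>*\<^sup>* T T' \<and>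
     (\<forall>p\<in>terminals T'. node_degree T' (Terminal p) = 1) \<and>
     (\<forall>s\<in>steiners T'. node_degree T' (Steiner s) = 3)"

text \<open>
  The labels and the shape of \<open>T\<^sup>*\<close> depend on the splits, but the multiset of its edge lengths,
  and hence \<open>beads\<close>, does not.
\<close>

definition star :: "embedded_graph \<Rightarrow> embedded_graph" where
  "star T = (SOME T'. full_splitting T T')"

definition beads :: "(point \<Rightarrow> point \<Rightarrow> real) \<Rightarrow> embedded_graph \<Rightarrow> int" where
  "beads d T = 1 - int (card (terminals T)) +
     (\<Sum>e\<in>edges (star T). \<lceil>edge_length d (star T) e\<rceil>)"

definition MSPT :: "(point \<Rightarrow> point \<Rightarrow> real) \<Rightarrow> point set \<Rightarrow> embedded_graph \<Rightarrow> bool" where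
  "MSPT d N T \<longleftrightarrow> interconnects T N \<and>
     (\<forall>T'. interconnects T' N \<longrightarrow> beads d T \<le> beads d T')"

end

theory Submission
  imports Defs "HOL-Library.Multiset"
begin

text \<open>
  Splitting a node adds one Steiner point and one edge of length zero, so by the handshake lemma
  all full splittings of a tree have the same multiset of edge lengths, with at most \<open>2n - 3\<close>
  members and with sum the length of the tree. Rounding up the edge lengths of \<open>T_S\<^sup>*\<close>
  changes nothing at integer lengths and adds less than \<open>1\<close> at each of the at most
  \<open>2n - 3 - j\<close> others; together with \<open>total_length T_S \<le> total_length T_opt\<close>, which
  is at most the sum of the rounded edge lengths of \<open>T_opt\<^sup>*\<close>, this bounds the
  difference, strictly unless all edge lengths of \<open>T_S\<^sup>*\<close> are integers.
\<close>

section \<open>Acyclic graphs\<close>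

text \<open>Consider a longest path, which exists because its vertices are distinct members of the
  finite set \<open>V\<close>. A neighbour of its first vertex \<open>h\<close> outside the path
  would prolong it, so all neighbours of \<open>h\<close> lie on the path, and one beyond the second
  vertex closes a cycle.\<close>

lemma min_degree_two_imp_cycle:
  fixes V :: "'v set"
  assumes "finite V" "V \<noteq> {}" and edge: "\<forall>e\<in>E. e \<subseteq> V \<and> card e = 2"
    and deg: "\<forall>v\<in>V. 2 \<le> card {e \<in> E. v \<in> e}"
  shows "\<exists>c. is_cycle E c"
proof -
  define path where "path p \<longleftrightarrow> p \<noteq> [] \<and> distinct p \<and> set p \<subseteq> V \<and>
    (\<forall>i. Suc i < length p \<longrightarrow> {p ! i, p ! Suc i} \<in> E)" for p
  obtain v0 where "v0 \<in> V" using assms by blast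
  then have single: "path [v0]" by (simp add: path_def)
  have bound: "length p \<le> card V" if "path p" for p
    using that card_mono[OF \<open>finite V\<close>, of "set p"] by (simp add: path_def distinct_card)
  then have "\<exists>p. path p \<and> (\<forall>q. path q \<longrightarrow> length q \<le> length p)"
    using single by (intro ex_has_greatest_nat[of path "[v0]" length "Suc (card V)"]) (auto simp: less_Suc_eq_le)
  then obtain p where p: "path p" and longest: "\<And>q. path q \<Longrightarrow> length q \<le> length p"
    by blast
  define h where "h = hd p"
  have h: "h = p ! 0" "h \<in> V" using p by (auto simp: h_def path_def hd_conv_nth)
  have neighbour: "x \<in> set p" "x \<noteq> h" if "{h, x} \<in> E" for x
  proof -
    show "x \<noteq> h" using edge that by force
    show "x \<in> set p"
    proof (rule ccontr)
      assume "x \<notin> set p"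
      moreover have "x \<in> V" using edge that by auto
      moreover have "{(x # p) ! i, (x # p) ! Suc i} \<in> E" if "Suc i < length (x # p)" for i
        using p that \<open>{h, x} \<in> E\<close> unfolding h(1)
        by (cases i) (simp_all add: path_def insert_commute[of x])
      ultimately have "path (x # p)" using p by (simp add: path_def)
      then show False using longest by fastforce
    qed
  qed
  \<comment> \<open>If the path has only one vertex, \<open>p ! 1\<close> is unspecified; this is
    harmless, since \<open>{h, p ! 1}\<close> only names one edge to be avoided.\<close>
  have "\<not> {e \<in> E. h \<in> e} \<subseteq> {{h, p ! 1}}"
  proof
    assume "{e \<in> E. h \<in> e} \<subseteq> {{h, p ! 1}}"
    then have "card {e \<in> E. h \<in> e} \<le> 1" using card_mono[of "{{h, p ! 1}}" "{e \<in> E. h \<in> e}"] by simp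
    moreover have "2 \<le> card {e \<in> E. h \<in> e}" using deg h(2) by blast
    ultimately show False by simp
  qed
  then obtain e where e: "e \<in> E" "h \<in> e" "e \<noteq> {h, p ! 1}" by blast
  then have "card e = 2" using edge by blast
  then obtain a b where "e = {a, b}" by (auto simp: card_2_iff)
  then obtain x where x: "e = {h, x}" using e(2) by blast
  then obtain i where i: "i < length p" "x = p ! i" using neighbour[of x] e by (metis in_set_conv_nth)
  \<comment> \<open>Position 0 is \<open>h\<close> itself and position 1 would give the excluded
    edge. Hence the prefix of the path ending in \<open>x\<close> has at least three vertices, and
    \<open>e\<close> closes it.\<close>
  have "i \<noteq> 0" "i \<noteq> 1" using neighbour[of x] e x i h by auto
  then have i2: "2 \<le> i" by simp
  have "is_cycle E (take (Suc i) p)"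
    unfolding is_cycle_def
  proof (intro conjI allI impI)
    show "3 \<le> length (take (Suc i) p)" "distinct (take (Suc i) p)"
      using i i2 p by (auto simp: path_def)
    fix k assume "k < length (take (Suc i) p)"
    then have k: "k \<le> i" and len: "length (take (Suc i) p) = Suc i" using i by auto
    show "{take (Suc i) p ! k, take (Suc i) p ! (Suc k mod length (take (Suc i) p))} \<in> E"
    proof (cases "k = i")
      case True
      have "{p ! i, p ! 0} \<in> E" using e(1) unfolding x i(2) h(1) by (simp only: insert_commute)
      then show ?thesis unfolding len using True by simp
    next
      case False
      then show ?thesis unfolding len using k p i by (simp add: path_def)
    qed
  qed
  then show ?thesis ..
qed

text \<open>By the cycle criterion some vertex has degree at most one; deleting it costs one vertex
  and at most one edge. The inequality is what bounds the number of edges of a full splitting from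
  above.\<close>

lemma acyclic_card_edges_less:
  fixes V :: "'v set"
  assumes "finite V" "V \<noteq> {}" "\<forall>e\<in>E. e \<subseteq> V \<and> card e = 2" "\<nexists>c. is_cycle E c"
  shows "card E < card V"
  using assms
proof (induction "card V" arbitrary: V E)
  case 0
  then show ?case by simp
next
  case (Suc m)
  have "\<exists>v\<in>V. card {e \<in> E. v \<in> e} < 2"
    using min_degree_two_imp_cycle[of V E] Suc.prems by force
  then obtain v where v: "v \<in> V" "card {e \<in> E. v \<in> e} < 2" by blast
  define E' where "E' = {e \<in> E. v \<notin> e}"
  have "E \<subseteq> Pow V" using Suc.prems by blast
  then have "finite E" using Suc.prems(1) finite_subset by blast
  have "card E = card E' + card {e \<in> E. v \<in> e}"
    using \<open>finite E\<close> by (subst card_Un_disjoint[symmetric]) (auto simp: E'_def intro: arg_cong[where f = card])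
  then have le: "card E \<le> card E' + 1" using v by simp
  show ?case
  \<comment> \<open>The induction hypothesis asks for a nonempty vertex set, so a single vertex is
    treated separately; it carries no two-element edge.\<close>
  proof (cases "V = {v}")
    case True
    have False if "e \<in> E" for e
    proof -
      have "e \<subseteq> {v}" "card e = 2" using Suc.prems(3) that True by auto
      then show False using card_mono[of "{v}" e] by simp
    qed
    then have "E = {}" by blast
    then show ?thesis using True by simp
  next
    case False
    have "\<nexists>c. is_cycle E' c" using Suc.prems(4) by (auto simp: is_cycle_def E'_def)
    moreover have "m = card (V - {v})" using Suc v by simp
    ultimately have "card E' < card (V - {v})"
      using Suc.hyps(1)[of "V - {v}" E'] Suc.prems False v by (auto simp: E'_def)
    then show ?thesis using le v Suc.prems(1) by simp
  qed
qed

section \<open>Splitting nodes\<close>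

text \<open>The invariant carried through splits. Being a tree is used for the original graph alone
  and is therefore not part of it.\<close>

definition wf_graph :: "embedded_graph \<Rightarrow> bool" where
  "wf_graph T \<longleftrightarrow> finite (terminals T) \<and> finite (steiners T) \<and>
     (\<forall>e\<in>edges T. e \<subseteq> nodes T \<and> card e = 2)"

lemma finite_nodes: "wf_graph T \<Longrightarrow> finite (nodes T)"
  by (simp add: wf_graph_def nodes_def)

lemma finite_edges: "wf_graph T \<Longrightarrow> finite (edges T)"
  by (rule finite_subset[of _ "Pow (nodes T)"]) (auto simp: finite_nodes, auto simp: wf_graph_def)

lemma card_nodes:
  assumes "wf_graph T"
  shows "card (nodes T) = card (terminals T) + card (steiners T)"
proof -
  have "card (nodes T) = card (Terminal ` terminals T) + card (Steiner ` steiners T)"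
    unfolding nodes_def using assms by (intro card_Un_disjoint) (auto simp: wf_graph_def)
  then show ?thesis by (simp add: card_image inj_on_def)
qed

text \<open>Double counting of incidences. The sum is separated by kind of node because a full
  splitting prescribes degree one at terminals and three at Steiner points, which turns the identity
  into a count of edges.\<close>

lemma handshake:
  assumes "wf_graph T"
  shows "(\<Sum>p\<in>terminals T. node_degree T (Terminal p)) + (\<Sum>s\<in>steiners T. node_degree T (Steiner s))
    = 2 * card (edges T)"
proof -
  have "(\<Sum>v\<in>nodes T. node_degree T v) = 2 * card (edges T)"
    unfolding node_degree_def
  proof (rule sum_multicount)
    show "finite (nodes T)" "finite (edges T)" using assms by (auto simp: finite_nodes finite_edges)
    show "\<forall>e\<in>edges T. card {v \<in> nodes T. v \<in> e} = 2"
    proof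
      fix e assume "e \<in> edges T"
      then have "{v \<in> nodes T. v \<in> e} = e" "card e = 2" using assms by (auto simp: wf_graph_def)
      then show "card {v \<in> nodes T. v \<in> e} = 2" by simp
    qed
  qed
  moreover have "(\<Sum>v\<in>nodes T. node_degree T v) =
      (\<Sum>v\<in>Terminal ` terminals T. node_degree T v) + (\<Sum>v\<in>Steiner ` steiners T. node_degree T v)"
    unfolding nodes_def using assms by (intro sum.union_disjoint) (auto simp: wf_graph_def)
  ultimately show ?thesis by (simp add: sum.reindex inj_on_def)
qed

lemma edge_length_doubleton:
  assumes "\<And>x y. d x y = d y x"
  shows "edge_length d T {x, y} = d (place T x) (place T y)"
  unfolding edge_length_def using assms by (intro the_equality) (auto simp: doubleton_eq_iff)

text \<open>Describes a split by one map on all edges, so that the new edge set is an injective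
  image of the old one together with the joining edge.\<close>

definition moved_edge :: "node \<Rightarrow> node set set \<Rightarrow> nat \<Rightarrow> node set \<Rightarrow> node set" where
  "moved_edge v F s e = (if e \<in> F then insert (Steiner s) (e - {v}) else e)"

locale splitting =
  fixes T :: embedded_graph and v :: node and F :: "node set set" and s :: nat
  assumes wf: "wf_graph T" and v: "v \<in> nodes T"
    and F: "F \<subseteq> {e \<in> edges T. v \<in> e}" and s: "s \<notin> steiners T"
begin

abbreviation "T' \<equiv> split_node T v F s"

lemma fresh: "Steiner s \<notin> nodes T"
  using s by (auto simp: nodes_def)

lemma v_neq: "v \<noteq> Steiner s"
  using v fresh by blast

lemma fresh_edge: "e \<in> edges T \<Longrightarrow> Steiner s \<notin> e"
  using wf fresh by (auto simp: wf_graph_def)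

lemma edges_split: "edges T' = insert {v, Steiner s} (moved_edge v F s ` edges T)"
  using F by (auto simp: split_node_def moved_edge_def)

lemma inj_moved: "inj_on (moved_edge v F s) (edges T)"
proof (rule inj_on_inverseI)
  fix e assume e: "e \<in> edges T"
  \<comment> \<open>The left inverse puts \<open>v\<close> back in place of
    \<open>Steiner s\<close>; it recognises the moved edges because the fresh node lies on no edge
    of \<open>T\<close>.\<close>
  show "(\<lambda>e. if Steiner s \<in> e then insert v (e - {Steiner s}) else e) (moved_edge v F s e) = e"
    using fresh_edge[OF e] F by (auto simp: moved_edge_def)
qed

text \<open>A moved edge has lost \<open>v\<close>, and an unmoved one does not contain
  \<open>Steiner s\<close>.\<close>

lemma new_edge: "{v, Steiner s} \<notin> moved_edge v F s ` edges T"
  using fresh_edge v_neq by (auto simp: moved_edge_def)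

lemma nodes_split: "nodes T' = insert (Steiner s) (nodes T)"
  by (auto simp: nodes_def split_node_def)

lemma terminals_split: "terminals T' = terminals T"
  by (simp add: split_node_def)

lemma steiners_split: "steiners T' = insert s (steiners T)"
  by (simp add: split_node_def)

lemma wf_split: "wf_graph T'"
  unfolding wf_graph_def
proof (intro conjI ballI)
  show "finite (terminals T')" "finite (steiners T')"
    using wf by (auto simp: wf_graph_def terminals_split steiners_split)
  fix e assume "e \<in> edges T'"
  then consider "e = {v, Steiner s}" | e0 where "e0 \<in> edges T" "e = moved_edge v F s e0"
    by (auto simp: edges_split)
  then have "e \<subseteq> nodes T' \<and> card e = 2"
  proof cases
    case 1
    then show ?thesis using v v_neq by (simp add: nodes_split)
  next
    case 2
    have e0: "e0 \<subseteq> nodes T" "card e0 = 2" "Steiner s \<notin> e0"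
      using wf 2 fresh_edge by (auto simp: wf_graph_def)
    then have "finite e0" using card.infinite by force
    have "v \<in> e0" if "e0 \<in> F" using that F by blast
    then show ?thesis using e0 2(2) \<open>finite e0\<close> by (auto simp: moved_edge_def nodes_split)
  qed
  then show "e \<subseteq> nodes T'" "card e = 2" by auto
qed

lemma card_edges_split: "card (edges T') = card (edges T) + 1"
  using finite_edges[OF wf] new_edge by (simp add: edges_split card_image inj_moved)

lemma card_steiners_split: "card (steiners T') = card (steiners T) + 1"
  using wf s by (simp add: wf_graph_def steiners_split)

lemma edge_length_new:
  assumes "\<And>x y. d x y = d y x" "\<And>x. d x x = 0"
  shows "edge_length d T' {v, Steiner s} = 0"
  using v_neq by (cases v) (auto simp: edge_length_doubleton[of d] assms split_node_def)

text \<open>The end \<open>v\<close> of a moved edge is replaced by a node at the same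
  position.\<close>

lemma edge_length_moved:
  assumes sym: "\<And>x y. d x y = d y x" and e: "e \<in> edges T"
  shows "edge_length d T' (moved_edge v F s e) = edge_length d T e"
proof -
  have place: "place T' x = place T x" if "x \<noteq> Steiner s" for x
    using that by (cases x) (auto simp: split_node_def)
  have place_s: "loc T' s = place T v"
    by (simp add: split_node_def)
  have e2: "card e = 2" using wf e by (auto simp: wf_graph_def)
  show ?thesis
  proof (cases "e \<in> F")
    case True
    then have "v \<in> e" using F by blast
    then obtain x where x: "e = {v, x}" "x \<noteq> v" using e2
      by (metis card_2_iff insert_commute insert_iff singletonD)
    then have "moved_edge v F s e = {Steiner s, x}" using True by (auto simp: moved_edge_def)
    then show ?thesis
      using x fresh_edge[OF e] by (auto simp: edge_length_doubleton[of d, OF sym] place place_s)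
  next
    case False
    obtain x y where x: "e = {x, y}" using e2 by (metis card_2_iff)
    then show ?thesis
      using False fresh_edge[OF e] by (auto simp: moved_edge_def edge_length_doubleton[of d, OF sym] place)
  qed
qed

lemma degree_other:
  assumes "u \<noteq> v" "u \<noteq> Steiner s"
  shows "node_degree T' u = node_degree T u"
proof -
  have "{e \<in> edges T'. u \<in> e} = moved_edge v F s ` {e \<in> edges T. u \<in> e}"
    using assms by (auto simp: edges_split moved_edge_def)
  then show ?thesis
    by (simp add: node_degree_def card_image inj_on_subset[OF inj_moved])
qed

lemma degree_new: "node_degree T' (Steiner s) = card F + 1"
proof -
  have "{e \<in> edges T'. Steiner s \<in> e} = insert {v, Steiner s} (moved_edge v F s ` F)"
    using F fresh_edge by (auto simp: edges_split moved_edge_def split: if_splits)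
  moreover have "{v, Steiner s} \<notin> moved_edge v F s ` F" using new_edge F by blast
  moreover have "card (moved_edge v F s ` F) = card F"
    using F by (intro card_image inj_on_subset[OF inj_moved]) auto
  moreover have "finite F" using F finite_edges[OF wf] by (auto intro: finite_subset)
  ultimately show ?thesis by (simp add: node_degree_def)
qed

text \<open>The node \<open>v\<close> loses the edges in \<open>F\<close> and gains the joining
  edge. The additive form avoids truncated subtraction.\<close>

lemma degree_split: "node_degree T' v + card F = node_degree T v + 1"
proof -
  have fin: "finite {e \<in> edges T. v \<in> e}" using finite_edges[OF wf] by simp
  have "{e \<in> edges T'. v \<in> e} = insert {v, Steiner s} ({e \<in> edges T. v \<in> e} - F)"
    using v_neq by (auto simp: edges_split moved_edge_def split: if_splits)
  moreover have "{v, Steiner s} \<notin> {e \<in> edges T. v \<in> e} - F" using fresh_edge by auto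
  ultimately have "node_degree T' v = card ({e \<in> edges T. v \<in> e} - F) + 1"
    using fin by (simp add: node_degree_def)
  moreover have "card ({e \<in> edges T. v \<in> e} - F) = node_degree T v - card F"
    unfolding node_degree_def using F fin by (intro card_Diff_subset) (auto intro: finite_subset)
  moreover have "card F \<le> node_degree T v"
    unfolding node_degree_def using F fin by (rule card_mono[rotated])
  ultimately show ?thesis by simp
qed

end

section \<open>Full splittings\<close>

text \<open>By the handshake identity the induction measure is the total excess of the degrees over
  the values 1 and 3. A split raises \<open>2 * card (edges T)\<close> by two and
  \<open>3 * card (steiners T)\<close> by three, so the excess drops by one. While it is positive, a
  split exists that respects the lower bounds on the degrees.\<close>

lemma ex_full_splitting:
  assumes "wf_graph T" "\<forall>p\<in>terminals T. 1 \<le> node_degree T (Terminal p)"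
    "\<forall>s\<in>steiners T. 3 \<le> node_degree T (Steiner s)"
  shows "\<exists>T'. full_splitting T T'"
  using assms
proof (induction "2 * card (edges T) - (card (terminals T) + 3 * card (steiners T))"
    arbitrary: T rule: less_induct)
  case less
  note wf = less.prems(1)
  show ?case
  proof (cases "(\<forall>p\<in>terminals T. node_degree T (Terminal p) = 1) \<and>
      (\<forall>s\<in>steiners T. node_degree T (Steiner s) = 3)")
    case True
    then show ?thesis by (auto simp: full_splitting_def)
  next
    case False
    have ter: "card (terminals T) \<le> (\<Sum>p\<in>terminals T. node_degree T (Terminal p))"
      using sum_mono[of "terminals T" "\<lambda>_. 1" "\<lambda>p. node_degree T (Terminal p)"] less.prems by simp
    have ste: "3 * card (steiners T) \<le> (\<Sum>s\<in>steiners T. node_degree T (Steiner s))"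
      using sum_mono[of "steiners T" "\<lambda>_. 3" "\<lambda>s. node_degree T (Steiner s)"] less.prems by simp
    \<comment> \<open>The measure is a truncated difference and can only drop if it is positive. If
      it were zero, equality of the sums would force equality in each term, so no degree would be
      too large.\<close>
    have strict: "card (terminals T) + 3 * card (steiners T) < 2 * card (edges T)"
    proof (rule ccontr)
      assume "\<not> ?thesis"
      then have eq: "(\<Sum>p\<in>terminals T. 1) = (\<Sum>p\<in>terminals T. node_degree T (Terminal p))"
        "(\<Sum>s\<in>steiners T. 3) = (\<Sum>s\<in>steiners T. node_degree T (Steiner s))"
        using ter ste handshake[OF wf] by simp_all
      have "\<forall>p\<in>terminals T. 1 = node_degree T (Terminal p)"
        using sum_mono_inv[OF eq(1)] less.prems by (auto simp: wf_graph_def)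
      moreover have "\<forall>s\<in>steiners T. 3 = node_degree T (Steiner s)"
        using sum_mono_inv[OF eq(2)] less.prems by (auto simp: wf_graph_def)
      ultimately show False using False by simp
    qed
    obtain s where s: "s \<notin> steiners T"
      using wf ex_new_if_finite[OF infinite_UNIV_nat, of "steiners T"] by (auto simp: wf_graph_def)
    text \<open>An overfull terminal gives all its edges to the new Steiner point, an overfull
      Steiner point only two.\<close>
    have "\<exists>v F. v \<in> nodes T \<and> F \<subseteq> {e \<in> edges T. v \<in> e} \<and> 2 \<le> card F \<and>
      (case v of Terminal p \<Rightarrow> card F = node_degree T v | Steiner t \<Rightarrow> card F + 2 \<le> node_degree T v)"
    proof (cases "\<forall>p\<in>terminals T. node_degree T (Terminal p) = 1")
      case True
      then obtain t where t: "t \<in> steiners T" "node_degree T (Steiner t) \<noteq> 3" using False by blast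
      then have "4 \<le> node_degree T (Steiner t)" using less.prems(3) by force
      moreover obtain F where "F \<subseteq> {e \<in> edges T. Steiner t \<in> e}" "card F = 2"
        using calculation obtain_subset_with_card_n[of 2 "{e \<in> edges T. Steiner t \<in> e}"]
        by (auto simp: node_degree_def)
      ultimately show ?thesis using t by (intro exI[of _ "Steiner t"] exI[of _ F]) (auto simp: nodes_def)
    next
      case False
      then obtain p where p: "p \<in> terminals T" "node_degree T (Terminal p) \<noteq> 1" by blast
      then have "2 \<le> node_degree T (Terminal p)" using less.prems(2) by force
      then show ?thesis using p
        by (intro exI[of _ "Terminal p"] exI[of _ "{e \<in> edges T. Terminal p \<in> e}"])
          (auto simp: nodes_def node_degree_def)
    qed
    then obtain v F where vF: "v \<in> nodes T" "F \<subseteq> {e \<in> edges T. v \<in> e}" "2 \<le> card F"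
      and case_v: "case v of Terminal p \<Rightarrow> card F = node_degree T v | Steiner t \<Rightarrow> card F + 2 \<le> node_degree T v"
      by blast
    interpret splitting T v F s using wf vF s by unfold_locales
    have step: "split_step T T'" using vF s by (rule split_step.intros)
    have "\<exists>T''. full_splitting T' T''"
    proof (rule less.hyps)
      show "2 * card (edges T') - (card (terminals T') + 3 * card (steiners T'))
        < 2 * card (edges T) - (card (terminals T) + 3 * card (steiners T))"
        using strict by (simp add: card_edges_split card_steiners_split terminals_split)
      show "wf_graph T'" by (rule wf_split)
      show "\<forall>p\<in>terminals T'. 1 \<le> node_degree T' (Terminal p)"
      proof
        fix p assume p: "p \<in> terminals T'"
        show "1 \<le> node_degree T' (Terminal p)"
        proof (cases "Terminal p = v")
          case True
          \<comment> \<open>All edges have left the terminal, so only the joining edge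
            remains.\<close>
          then show ?thesis using degree_split case_v by auto
        next
          case False
          then show ?thesis using degree_other p less.prems(2) by (simp add: terminals_split)
        qed
      qed
      show "\<forall>t\<in>steiners T'. 3 \<le> node_degree T' (Steiner t)"
      proof
        fix t assume t: "t \<in> steiners T'"
        \<comment> \<open>The new point has degree \<open>card F + 1\<close>, and a split Steiner
          point keeps degree \<open>node_degree T v + 1 - card F\<close>; the choice of
          \<open>F\<close> makes both at least three.\<close>
        consider "t = s" | "Steiner t = v" | "t \<noteq> s" "Steiner t \<noteq> v" by blast
        then show "3 \<le> node_degree T' (Steiner t)"
        proof cases
          case 1
          then show ?thesis using degree_new vF by simp
        next
          case 2
          then show ?thesis using degree_split case_v by auto
        next
          case 3
          then show ?thesis using degree_other t less.prems(3) by (simp add: steiners_split)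
        qed
      qed
    qed
    then show ?thesis
      using step unfolding full_splitting_def by (meson converse_rtranclp_into_rtranclp)
  qed
qed

section \<open>Invariance of the multiset of edge lengths\<close>

text \<open>As a multiset, the lengths can be compared between graphs with different edge sets, and
  both the total length and the rounded sum can be read off.\<close>

definition edge_lengths :: "(point \<Rightarrow> point \<Rightarrow> real) \<Rightarrow> embedded_graph \<Rightarrow> real multiset" where
  "edge_lengths d T = image_mset (edge_length d T) (mset_set (edges T))"

lemma (in splitting) edge_lengths_split:
  assumes "\<And>x y. d x y = d y x" "\<And>x. d x x = 0"
  shows "edge_lengths d T' = add_mset 0 (edge_lengths d T)"
proof -
  have "edge_lengths d T' =
      add_mset 0 (image_mset (edge_length d T') (image_mset (moved_edge v F s) (mset_set (edges T))))"
    using finite_edges[OF wf] new_edge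
    by (simp add: edge_lengths_def edges_split edge_length_new assms image_mset_mset_set inj_moved)
  also have "image_mset (edge_length d T') (image_mset (moved_edge v F s) (mset_set (edges T)))
      = edge_lengths d T"
    unfolding edge_lengths_def multiset.map_comp
    using finite_edges[OF wf] by (intro image_mset_cong) (simp add: edge_length_moved assms)
  finally show ?thesis .
qed

text \<open>Each split contributes exactly one zero length, one edge and one Steiner point, so the
  same \<open>k\<close>, the number of splits, serves all three counts.\<close>

lemma split_steps_invariants:
  assumes "split_step\<^sup>*\<^sup>* T T'" "wf_graph T" "\<And>x y. d x y = d y x" "\<And>x. d x x = 0"
  shows "wf_graph T' \<and> terminals T' = terminals T \<and>
    (\<exists>k. edge_lengths d T' = edge_lengths d T + replicate_mset k 0 \<and>
      card (edges T') = card (edges T) + k \<and> card (steiners T') = card (steiners T) + k)"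
  using assms(1)
proof (induction rule: rtranclp_induct)
  case base
  then show ?case using assms(2) by auto
next
  case (step T1 T2)
  then obtain k where k: "edge_lengths d T1 = edge_lengths d T + replicate_mset k 0"
      "card (edges T1) = card (edges T) + k" "card (steiners T1) = card (steiners T) + k" by blast
  from step(2) show ?case
  proof cases
    case (1 v F s)
    interpret splitting T1 v F s using 1 step.IH by unfold_locales auto
    show ?thesis unfolding 1(1)
      using step.IH k wf_split edge_lengths_split[of d] assms(3,4)
      by (auto simp: terminals_split card_edges_split card_steiners_split intro!: exI[of _ "Suc k"])
  qed
qed

text \<open>With \<open>n\<close> terminals, \<open>s\<close> Steiner points and \<open>m\<close>
  edges in \<open>T\<close>, the handshake identity for \<open>T'\<close> reads
  \<open>n + 3 * (s + k) = 2 * (m + k)\<close>. Hence \<open>k\<close> is determined by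
  \<open>T\<close> alone.\<close>

lemma full_splitting_invariants:
  assumes T': "full_splitting T T'" and wf: "wf_graph T"
    and d: "\<And>x y. d x y = d y x" "\<And>x. d x x = 0"
  shows "\<exists>k. edge_lengths d T' = edge_lengths d T + replicate_mset k 0 \<and>
    card (edges T') = card (edges T) + k \<and>
    card (terminals T) + 3 * card (steiners T) + k = 2 * card (edges T) \<and> finite (edges T')"
proof -
  have inv: "wf_graph T'" "terminals T' = terminals T"
    using split_steps_invariants[of T T' d] T' wf d by (auto simp: full_splitting_def)
  obtain k where k: "edge_lengths d T' = edge_lengths d T + replicate_mset k 0"
      "card (edges T') = card (edges T) + k" "card (steiners T') = card (steiners T) + k"
    using split_steps_invariants[of T T' d] T' wf d by (auto simp: full_splitting_def)
  have "card (terminals T') + 3 * card (steiners T') = 2 * card (edges T')"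
    using handshake[OF inv(1)] T' by (simp add: full_splitting_def)
  then show ?thesis using k inv finite_edges by (intro exI[of _ k]) auto
qed

text \<open>Both splittings add the same number of zeros to the lengths of \<open>T\<close>, since
  that number depends on \<open>T\<close> only.\<close>

lemma full_splitting_edge_lengths_unique:
  assumes "full_splitting T T1" "full_splitting T T2" "wf_graph T"
    and "\<And>x y. d x y = d y x" "\<And>x. d x x = 0"
  shows "edge_lengths d T1 = edge_lengths d T2"
proof -
  obtain k1 where "edge_lengths d T1 = edge_lengths d T + replicate_mset k1 0"
      "card (terminals T) + 3 * card (steiners T) + k1 = 2 * card (edges T)"
    using full_splitting_invariants[of T T1 d] assms by blast
  moreover obtain k2 where "edge_lengths d T2 = edge_lengths d T + replicate_mset k2 0"
      "card (terminals T) + 3 * card (steiners T) + k2 = 2 * card (edges T)"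
    using full_splitting_invariants[of T T2 d] assms by blast
  moreover have "k1 = k2" using calculation by linarith
  ultimately show ?thesis by simp
qed

section \<open>Total length and bead count from the multiset\<close>

lemma sum_edges_eq_sum_mset:
  "(\<Sum>e\<in>edges T. f (edge_length d T e)) = (\<Sum>x\<in>#edge_lengths d T. f x)"
  by (simp add: edge_lengths_def sum_unfold_sum_mset multiset.map_comp comp_def)

lemma full_splitting_total_length:
  assumes "full_splitting T T'" "wf_graph T" "\<And>x y. d x y = d y x" "\<And>x. d x x = 0"
  shows "(\<Sum>e\<in>edges T'. edge_length d T' e) = total_length d T"
proof -
  obtain k where "edge_lengths d T' = edge_lengths d T + replicate_mset k 0"
    using full_splitting_invariants[of T T' d] assms by blast
  then show ?thesis
    using sum_edges_eq_sum_mset[of "\<lambda>x. x" d T'] sum_edges_eq_sum_mset[of "\<lambda>x. x" d T]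
    by (simp add: total_length_def)
qed

text \<open>Replaces the arbitrary choice made by \<open>star\<close> with whichever full splitting
  is at hand.\<close>

lemma beads_eq:
  assumes "full_splitting T T'" "wf_graph T" "\<And>x y. d x y = d y x" "\<And>x. d x x = 0"
  shows "beads d T = 1 - int (card (terminals T)) + (\<Sum>e\<in>edges T'. \<lceil>edge_length d T' e\<rceil>)"
proof -
  have "full_splitting T (star T)" unfolding star_def using assms(1) by (rule someI)
  then have "edge_lengths d (star T) = edge_lengths d T'"
    using full_splitting_edge_lengths_unique[of T "star T" T' d] assms by blast
  then show ?thesis by (simp add: beads_def sum_edges_eq_sum_mset)
qed

section \<open>Trees interconnecting the terminals\<close>

lemma interconnects_wf: "interconnects T N \<Longrightarrow> finite N \<Longrightarrow> wf_graph T"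
  by (auto simp: interconnects_def wf_graph_def is_tree_def)

text \<open>With at least two terminals, connectedness gives every terminal an edge: the first one
  on a walk to another terminal.\<close>

lemma interconnects_ex_full_splitting:
  assumes T: "interconnects T N" and N: "finite N" "2 \<le> card N"
  shows "\<exists>T'. full_splitting T T'"
proof (rule ex_full_splitting)
  show wf: "wf_graph T" using interconnects_wf T N by blast
  show "\<forall>s\<in>steiners T. 3 \<le> node_degree T (Steiner s)" using T by (auto simp: interconnects_def)
  show "\<forall>p\<in>terminals T. 1 \<le> node_degree T (Terminal p)"
  proof
    fix p assume p: "p \<in> terminals T"
    have tN: "terminals T = N" using T by (simp add: interconnects_def)
    have "\<not> N \<subseteq> {p}" using N card_mono[of "{p}" N] by auto
    then obtain q where q: "q \<in> terminals T" "q \<noteq> p" using tN by blast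
    have "(Terminal p, Terminal q) \<in> {(x, y). {x, y} \<in> edges T}\<^sup>*"
      using T p q by (auto simp: interconnects_def is_tree_def nodes_def)
    then obtain z where "{Terminal p, z} \<in> edges T"
      using q by (auto elim: converse_rtranclE)
    then have "{e \<in> edges T. Terminal p \<in> e} \<noteq> {}" by auto
    then have "0 < node_degree T (Terminal p)"
      using finite_edges[OF wf] unfolding node_degree_def by (subst card_gt_0_iff) auto
    then show "1 \<le> node_degree T (Terminal p)" by simp
  qed
qed

text \<open>With \<open>n\<close>, \<open>s\<close>, \<open>m\<close> counting terminals, Steiner
  points and edges of \<open>T\<close>, and \<open>k\<close> splits,
  \<open>k = 2 * m - n - 3 * s\<close>. Since \<open>m \<le> n + s - 1\<close>, the splitting has
  \<open>m + k = 3 * m - n - 3 * s \<le> 2 * n - 3\<close> edges.\<close>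

lemma card_edges_full_splitting:
  assumes T: "interconnects T N" and N: "finite N" and T': "full_splitting T T'"
  shows "card (edges T') + 3 \<le> 2 * card N"
proof -
  have wf: "wf_graph T" using interconnects_wf T N by blast
  obtain k where k: "card (edges T') = card (edges T) + k"
      "card (terminals T) + 3 * card (steiners T) + k = 2 * card (edges T)"
    \<comment> \<open>Only the counts matter here, so the zero function stands in for the
      metric.\<close>
    using full_splitting_invariants[of T T' "\<lambda>_ _. 0"] wf T' by auto
  have "card (edges T) < card (nodes T)"
    using T by (intro acyclic_card_edges_less) (auto simp: interconnects_def is_tree_def)
  then show ?thesis using k T card_nodes[OF wf] by (simp add: interconnects_def)
qed

section \<open>Rounding and the final estimate\<close>

text \<open>Rounding up adds less than 1 at each non-integer value and nothing elsewhere. With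
  \<open>B\<close> the set of non-integer places, the rounded sum is strictly below the integer
  \<open>m + card B\<close> if \<open>B\<close> is nonempty, which by integrality gains the extra 1.
  If \<open>B\<close> is empty, the rounded sum is at most \<open>m\<close>, whence the maximum with
  0.\<close>

lemma sum_ceiling_bound:
  fixes f :: "'a \<Rightarrow> real"
  assumes A: "finite A" and le: "(\<Sum>x\<in>A. f x) \<le> of_int m"
  shows "(\<Sum>x\<in>A. \<lceil>f x\<rceil>) - m \<le> max (int (card A) - 1 - int (card {x \<in> A. f x \<in> \<int>})) 0"
proof -
  define B where "B = {x \<in> A. f x \<notin> \<int>}"
  define g where "g x = of_int \<lceil>f x\<rceil> - f x" for x
  have "(\<Sum>x\<in>A. g x) = (\<Sum>x\<in>B. g x)"
    using A by (intro sum.mono_neutral_right) (auto simp: B_def g_def elim!: Ints_cases)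
  then have diff: "of_int (\<Sum>x\<in>A. \<lceil>f x\<rceil>) = (\<Sum>x\<in>A. f x) + (\<Sum>x\<in>B. g x)"
    by (simp add: g_def sum_subtractf)
  have card: "card A = card B + card {x \<in> A. f x \<in> \<int>}"
    using A by (subst card_Un_disjoint[symmetric]) (auto simp: B_def intro: arg_cong[where f = card])
  have g1: "g x < 1" for x unfolding g_def by linarith
  show ?thesis
  proof (cases "B = {}")
    case True
    then have "(of_int (\<Sum>x\<in>A. \<lceil>f x\<rceil>) :: real) \<le> of_int m" using diff le by simp
    then have "(\<Sum>x\<in>A. \<lceil>f x\<rceil>) \<le> m" unfolding of_int_le_iff .
    then show ?thesis by simp
  next
    case False
    have "(\<Sum>x\<in>B. g x) < (\<Sum>x\<in>B. 1)"
      using A False g1 by (intro sum_strict_mono) (auto simp: B_def)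
    then have "of_int (\<Sum>x\<in>A. \<lceil>f x\<rceil>) < (of_int (m + int (card B)) :: real)"
      using diff le by simp
    then have "(\<Sum>x\<in>A. \<lceil>f x\<rceil>) < m + int (card B)" unfolding of_int_less_iff .
    then show ?thesis using card by simp
  qed
qed

theorem proposition3:
  fixes \<nu> :: "point \<Rightarrow> real" and d :: "point \<Rightarrow> point \<Rightarrow> real"
    and N :: "point set" and n j :: nat
    and T_S T_S_star T_opt :: embedded_graph
  assumes "is_norm \<nu>"
    and "\<And>x y. d x y = \<nu> (x - y)"
    and "finite N" and "card N = n" and "n \<ge> 2"
    and "SMT d N T_S"
    and "MSPT d N T_opt"
    and "full_splitting T_S T_S_star"
    and "j = card {e \<in> edges T_S_star. edge_length d T_S_star e \<in> \<int>}"
  shows "beads d T_S - beads d T_opt \<le> max (2 * int n - 4 - int j) 0"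
proof -
  have "\<nu> (x - y) = \<nu> (y - x)" for x y
  proof -
    have "\<nu> ((- 1) *\<^sub>R (y - x)) = \<bar>- 1\<bar> * \<nu> (y - x)"
      using assms(1) unfolding is_norm_def by blast
    then show ?thesis by simp
  qed
  then have sym: "d x y = d y x" for x y using assms(2) by simp
  have zero: "d x x = 0" for x using assms(1,2) by (simp add: is_norm_def)
  have S: "interconnects T_S N" and opt: "interconnects T_opt N"
    using assms(6,7) by (auto simp: SMT_def MSPT_def)
  have wfS: "wf_graph T_S" and wfopt: "wf_graph T_opt"
    using interconnects_wf S opt assms(3) by auto
  obtain U where U: "full_splitting T_opt U"
    using interconnects_ex_full_splitting[OF opt] assms(3-5) by blast
  have terms: "card (terminals T_S) = n" "card (terminals T_opt) = n"
    using S opt assms(4) by (auto simp: interconnects_def)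
  have "(\<Sum>e\<in>edges T_S_star. edge_length d T_S_star e) = total_length d T_S"
    by (rule full_splitting_total_length[OF assms(8) wfS sym zero])
  also have "\<dots> \<le> total_length d T_opt"
    using assms(6) opt by (simp add: SMT_def)
  also have "\<dots> = (\<Sum>e\<in>edges U. edge_length d U e)"
    by (rule full_splitting_total_length[OF U wfopt sym zero, symmetric])
  \<comment> \<open>Rounding up on this side makes the bound an integer, as the rounding estimate
    demands, and it is the very sum that occurs in \<open>beads d T_opt\<close>.\<close>
  also have "\<dots> \<le> (\<Sum>e\<in>edges U. of_int \<lceil>edge_length d U e\<rceil>)"
    by (intro sum_mono le_of_int_ceiling)
  finally have le: "(\<Sum>e\<in>edges T_S_star. edge_length d T_S_star e)
      \<le> of_int (\<Sum>e\<in>edges U. \<lceil>edge_length d U e\<rceil>)" by simp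
  have fin: "finite (edges T_S_star)"
    using full_splitting_invariants[OF assms(8) wfS sym zero] by blast
  have m: "card (edges T_S_star) + 3 \<le> 2 * n"
    using card_edges_full_splitting[OF S assms(3) assms(8)] assms(4) by simp
  have "beads d T_S - beads d T_opt
      = (\<Sum>e\<in>edges T_S_star. \<lceil>edge_length d T_S_star e\<rceil>) - (\<Sum>e\<in>edges U. \<lceil>edge_length d U e\<rceil>)"
    using beads_eq[OF assms(8) wfS sym zero] beads_eq[OF U wfopt sym zero] terms by simp
  also have "\<dots> \<le> max (int (card (edges T_S_star)) - 1 - int j) 0"
    unfolding assms(9) by (rule sum_ceiling_bound[OF fin le])
  \<comment> \<open>The constant 4 is the 3 from the edge count plus the 1 gained by
    integrality.\<close>
  also have "\<dots> \<le> max (2 * int n - 4 - int j) 0" using m by simp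
  finally show ?thesis .
qed

end
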